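(* Let $(X_t)_{t\ge 0}$ be an irreducible, nonexplosive, positive recurrent birth--death process on $\mathbb{N}$ with birth rates $\lambda$, death rates $\nu$ and stationary distribution $\mu$. Assume that there exists $u\in\mathcal{F}_+$ such that the associated Wasserstein curvature $\sigma_u$ is positive. Then the Poincaré inequality $$c\,\mathrm{Var}_\mu(f)\le\mathcal{E}_\mu(f,f)\qquad\text{for all } f\in\mathcal{D}(\mathcal{E}_\mu)$$ holds with constant $c=\sup_{u\in\mathcal{F}_+}\sigma_u$; in other words, the optimal (largest) constant $c_{\mathrm{P}}$ in this inequality satisfies $$c_{\mathrm{P}}\ge\sup_{u\in\mathcal{F}_+}\sigma_u.$$
   Context: $\mathbb{N}=\{0,1,2,\dots\}$. A birth--death process $(X_t)_{t\ge0}$ with birth rates $\lambda_x$ and death rates $\nu_x$ is the continuous-time Markov chain on $\mathbb{N}$ with generator $\mathcal{L}f(x)=\lambda_x\,\partial f(x)+\nu_x\,\partial^* f(x)$, where $\partial f(x)=f(x+1)-f(x)$, $\partial^*f(x)=f(x-1)-f(x)$. Irreducible means $\lambda_x>0$ for all $x\in\mathbb{N}$, $\nu_x>0$ for all $x\ge1$ and $\nu_0=0$. Nonexplosive means $\sum_{x\ge1}\left(\frac1{\lambda_x}+\frac{\nu_x}{\lambda_x\lambda_{x-1}}+\cdots+\frac{\nu_x\cdots\nu_1}{\lambda_x\cdots\lambda_1\lambda_0}\right)=\infty$. Positive recurrent means $\sum_{x\ge1}\frac{\lambda_0\cdots\lambda_{x-1}}{\nu_1\cdots\nu_x}<\infty$;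 the stationary distribution is then $\mu(x)=\mu(0)\prod_{y=1}^x\frac{\lambda_{y-1}}{\nu_y}$ with $\mu(0)$ the normalizing constant, and it is reversible. The Dirichlet form is $\mathcal{E}_\mu(f,g)=\int_{\mathbb{N}}\lambda\,\partial f\,\partial g\,d\mu$, with domain $\mathcal{D}(\mathcal{E}_\mu)=\{f\in L^2(\mu):\mathcal{E}_\mu(f,f)<\infty\}$, and $\mathrm{Var}_\mu(f)=\mu(f^2)-\mu(f)^2$, $\mu(f)=\int f\,d\mu$. For $u:\mathbb{N}\to(0,\infty)$ the $u$-modification is the (minimal) birth--death process with birth rates $\lambda^u_x=\frac{u_{x+1}}{u_x}\lambda_{x+1}$ and death rates $\nu^u_x=\frac{u_{x-1}}{u_x}\nu_x$ ($\nu^u_0=0$), with semigroup $(P_{u,t})_{t\ge0}$; the potential is $V_u(x)=\nu_{x+1}-\nu^u_x+\lambda_x-\lambda^u_x$. The Wasserstein curvature (Chen exponent) is $\sigma_u=\inf_{x\in\mathbb{N}}V_u(x)\in[-\infty,\infty)$. $\mathcal{F}_+$ is the set of functions $u:\mathbb{N}\to(0,\infty)$, restricted by the standing assumption that $\lambda^u$, $\nu^u$ and $V_u$ are $P_{u,t}$-integrable, i.e. $P_{u,t}(\lambda^u+\nu^u+|V_u|)(x)<\infty$ for all $x\in\mathbb{N}$, $t\ge0$. *)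

theory Defs
  imports "HOL-Analysis.Analysis"
begin

definition irreducible_rates :: "(nat \<Rightarrow> real) \<Rightarrow> (nat \<Rightarrow> real) \<Rightarrow> bool" where
  "irreducible_rates lam nu \<longleftrightarrow> (\<forall>x. lam x > 0) \<and> (\<forall>x\<ge>1. nu x > 0) \<and> nu 0 = 0"

text \<open>The \<open>k\<close>-th summand is \<open>\<nu>\<^sub>x \<cdots> \<nu>\<^bsub>k+1\<^esub> / (\<lambda>\<^sub>x \<cdots> \<lambda>\<^sub>k)\<close>; the series has nonnegative
  terms, so its sum is infinite iff it is not summable. The argument \<open>Suc x\<close> makes it
  start at 1.\<close>

definition nonexplosive :: "(nat \<Rightarrow> real) \<Rightarrow> (nat \<Rightarrow> real) \<Rightarrow> bool" where
  "nonexplosive lam nu \<longleftrightarrow>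
     \<not> summable (\<lambda>x. \<Sum>k\<le>Suc x. (\<Prod>j\<in>{k<..Suc x}. nu j) / (\<Prod>j\<in>{k..Suc x}. lam j))"

definition bd_weight :: "(nat \<Rightarrow> real) \<Rightarrow> (nat \<Rightarrow> real) \<Rightarrow> nat \<Rightarrow> real" where
  "bd_weight lam nu x = (\<Prod>y=1..x. lam (y - 1) / nu y)"

definition positive_recurrent :: "(nat \<Rightarrow> real) \<Rightarrow> (nat \<Rightarrow> real) \<Rightarrow> bool" where
  "positive_recurrent lam nu \<longleftrightarrow> summable (\<lambda>x. bd_weight lam nu (Suc x))"

definition stationary :: "(nat \<Rightarrow> real) \<Rightarrow> (nat \<Rightarrow> real) \<Rightarrow> nat measure" where
  "stationary lam nu =
     density (count_space UNIV)
       (\<lambda>x. ennreal (bd_weight lam nu x / (\<Sum>y. bd_weight lam nu y)))"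

definition fwd_diff :: "(nat \<Rightarrow> real) \<Rightarrow> nat \<Rightarrow> real" where
  "fwd_diff f x = f (x + 1) - f x"

definition dirichlet_form ::
  "(nat \<Rightarrow> real) \<Rightarrow> (nat \<Rightarrow> real) \<Rightarrow> (nat \<Rightarrow> real) \<Rightarrow> (nat \<Rightarrow> real) \<Rightarrow> real" where
  "dirichlet_form lam nu f g =
     (\<integral>x. lam x * fwd_diff f x * fwd_diff g x \<partial>stationary lam nu)"

text \<open>Finiteness of the energy is expressed by the nonnegative integral, because the Bochner
  integral in \<^const>\<open>dirichlet_form\<close> is 0 for a non-integrable integrand.\<close>

definition dirichlet_domain :: "(nat \<Rightarrow> real) \<Rightarrow> (nat \<Rightarrow> real) \<Rightarrow> (nat \<Rightarrow> real) set" where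
  "dirichlet_domain lam nu =
     {f. integrable (stationary lam nu) (\<lambda>x. (f x)\<^sup>2) \<and>
         (\<integral>\<^sup>+x. ennreal (lam x * fwd_diff f x * fwd_diff f x) \<partial>stationary lam nu) < \<infinity>}"

definition variance_wrt :: "nat measure \<Rightarrow> (nat \<Rightarrow> real) \<Rightarrow> real" where
  "variance_wrt M f = (\<integral>x. (f x)\<^sup>2 \<partial>M) - (\<integral>x. f x \<partial>M)\<^sup>2"

definition poincare_inequality :: "(nat \<Rightarrow> real) \<Rightarrow> (nat \<Rightarrow> real) \<Rightarrow> real \<Rightarrow> bool" where
  "poincare_inequality lam nu c \<longleftrightarrow>
     (\<forall>f\<in>dirichlet_domain lam nu.
        c * variance_wrt (stationary lam nu) f \<le> dirichlet_form lam nu f f)"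

definition poincare_constant :: "(nat \<Rightarrow> real) \<Rightarrow> (nat \<Rightarrow> real) \<Rightarrow> ereal" where
  "poincare_constant lam nu = (SUP c\<in>{c. poincare_inequality lam nu c}. ereal c)"

text \<open>Feller's construction of the minimal birth--death process with birth rates \<open>b\<close> and death
  rates \<open>d\<close> (\<open>d 0 = 0\<close>): \<open>bd_iter b d n t x y\<close> is the probability, starting from \<open>x\<close>, of being
  at \<open>y\<close> at time \<open>t\<close> after fewer than \<open>n\<close> jumps, obtained by conditioning on the first jump.
  The supremum over \<open>n\<close> is the minimal nonnegative solution of the (integrated) backward
  Kolmogorov equation. It is sub-Markovian in case of explosion: mass that has exploded is
  lost. Since \<open>d 0 = 0\<close>, the truncated \<open>x - 1\<close> is harmless at \<open>x = 0\<close>.\<close>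

primrec bd_iter ::
  "(nat \<Rightarrow> real) \<Rightarrow> (nat \<Rightarrow> real) \<Rightarrow> nat \<Rightarrow> real \<Rightarrow> nat \<Rightarrow> nat \<Rightarrow> ennreal" where
  "bd_iter b d 0 = (\<lambda>t x y. 0)"
| "bd_iter b d (Suc n) = (\<lambda>t x y.
     (if x = y then ennreal (exp (- (b x + d x) * t)) else 0) +
     (\<integral>\<^sup>+s\<in>{0..t}. ennreal (exp (- (b x + d x) * s)) *
        (ennreal (b x) * bd_iter b d n (t - s) (x + 1) y +
         ennreal (d x) * bd_iter b d n (t - s) (x - 1) y) \<partial>lborel))"

definition bd_transition ::
  "(nat \<Rightarrow> real) \<Rightarrow> (nat \<Rightarrow> real) \<Rightarrow> real \<Rightarrow> nat \<Rightarrow> nat \<Rightarrow> ennreal" where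
  "bd_transition b d t x y = (SUP n. bd_iter b d n t x y)"

text \<open>The minimal semigroup acting on nonnegative functions.\<close>

definition bd_semigroup ::
  "(nat \<Rightarrow> real) \<Rightarrow> (nat \<Rightarrow> real) \<Rightarrow> real \<Rightarrow> (nat \<Rightarrow> ennreal) \<Rightarrow> nat \<Rightarrow> ennreal" where
  "bd_semigroup b d t f x = (\<Sum>y. bd_transition b d t x y * f y)"

definition mod_birth :: "(nat \<Rightarrow> real) \<Rightarrow> (nat \<Rightarrow> real) \<Rightarrow> nat \<Rightarrow> real" where
  "mod_birth lam u x = u (x + 1) / u x * lam (x + 1)"

definition mod_death :: "(nat \<Rightarrow> real) \<Rightarrow> (nat \<Rightarrow> real) \<Rightarrow> nat \<Rightarrow> real" where
  "mod_death nu u x = (if x = 0 then 0 else u (x - 1) / u x * nu x)"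

definition potential :: "(nat \<Rightarrow> real) \<Rightarrow> (nat \<Rightarrow> real) \<Rightarrow> (nat \<Rightarrow> real) \<Rightarrow> nat \<Rightarrow> real" where
  "potential lam nu u x = nu (x + 1) - mod_death nu u x + lam x - mod_birth lam u x"

definition wasserstein_curvature ::
  "(nat \<Rightarrow> real) \<Rightarrow> (nat \<Rightarrow> real) \<Rightarrow> (nat \<Rightarrow> real) \<Rightarrow> ereal" where
  "wasserstein_curvature lam nu u = (INF x. ereal (potential lam nu u x))"

definition F_plus :: "(nat \<Rightarrow> real) \<Rightarrow> (nat \<Rightarrow> real) \<Rightarrow> (nat \<Rightarrow> real) set" where
  "F_plus lam nu =
     {u. (\<forall>x. u x > 0) \<and>
         (\<forall>x. \<forall>t\<ge>0. bd_semigroup (mod_birth lam u) (mod_death nu u) t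
            (\<lambda>y. ennreal (mod_birth lam u y + mod_death nu u y + \<bar>potential lam nu u y\<bar>)) x < \<infinity>)}"

end

theory Submission
  imports Defs
begin

text \<open>
  Write \<open>p\<close> for the stationary distribution and \<open>m x = p x * lam x\<close> for the conductances. The
  difference operator intertwines the generator with a second-order operator on gradients, and
  the hypothesis \<open>potential lam nu u \<ge> c\<close> says that the positive function \<open>u\<close> is a
  supersolution of that operator at level \<open>c\<close>. By the discrete Barta (ground state) argument,
  the existence of a positive supersolution forces the quadratic form to be bounded below by
  \<open>c\<close>: for every sequence \<open>H\<close> that vanishes at both ends of a finite window,
  \<open>c * (\<Sum> (H (Suc x))\<^sup>2 / m x) \<le> \<Sum> (H (Suc x) - H x)\<^sup>2 / p x\<close>
  (lemma \<open>weighted_hardy_of_potential\<close>).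

  This Hardy inequality is dual to the Poincare inequality. If \<open>f\<close> is centred on the window
  \<open>{..N}\<close>, then \<open>H x = (\<Sum>y<x. p y * f y)\<close> vanishes at both ends, its increments divided by \<open>p\<close>
  are \<open>f\<close>, and summation by parts writes the variance of \<open>f\<close> as \<open>- (\<Sum> H (Suc x) * (f (Suc x) - f x))\<close>.
  Young's inequality and the Hardy inequality then bound the variance by the energy divided by
  \<open>c\<close> (lemma \<open>finite_window_poincare\<close>). Letting \<open>N\<close> tend to infinity gives the inequality for
  the whole chain.

  Finally, the supremum of the curvatures is finite since every curvature is at most
  \<open>potential lam nu u 0 \<le> nu 1 + lam 0\<close>, and the Poincare inequality, being linear in the
  constant, passes to the supremum.
\<close>

section \<open>The Hardy inequality dual to the Poincare inequality\<close>

text \<open>The ground-state inequality for one edge: after expansion it is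
  \<open>2 * h * k \<le> r * h\<^sup>2 + k\<^sup>2 / r\<close>.\<close>

lemma square_diff_ground_state:
  fixes h k r :: real
  assumes "r > 0"
  shows "(1 - r) * h\<^sup>2 + (1 - 1 / r) * k\<^sup>2 \<le> (h - k)\<^sup>2"
proof -
  have "0 \<le> (r * h - k)\<^sup>2 / r"
    using assms by simp
  also have "\<dots> = (h - k)\<^sup>2 - ((1 - r) * h\<^sup>2 + (1 - 1 / r) * k\<^sup>2)"
    using assms by (simp add: field_simps power2_eq_square)
  finally show ?thesis by simp
qed

text \<open>Applying the ground-state inequality at each edge, with \<open>r\<close> the ratio of consecutive values
  of \<open>p * lam * u\<close>, splits the right-hand side into diagonal terms; the two contributions
  to \<open>(H (Suc x))\<^sup>2\<close>, from the edges on either side, add up to the potential at \<open>x\<close>.\<close>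

lemma weighted_hardy_of_potential:
  fixes p lam nu u H :: "nat \<Rightarrow> real" and c :: real
  assumes p: "\<And>x. p x > 0"
    and irr: "irreducible_rates lam nu"
    and reversible: "\<And>x. p x * lam x = p (Suc x) * nu (Suc x)"
    and u: "\<And>x. u x > 0"
    and potential: "\<And>x. c \<le> potential lam nu u x"
    and H0: "H 0 = 0" and HN: "H (Suc N) = 0"
  shows "c * (\<Sum>x<N. (H (Suc x))\<^sup>2 / (p x * lam x)) \<le> (\<Sum>x\<le>N. (H (Suc x) - H x)\<^sup>2 / p x)"
proof -
  define m where "m x = p x * lam x" for x
  define A where "A x = (lam x - mod_death nu u x) / m x * (H (Suc x))\<^sup>2" for x
  define B where "B x = (nu (Suc x) - mod_birth lam u x) / m x * (H (Suc x))\<^sup>2" for x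
  have lam: "lam x > 0" and nu: "nu (Suc x) > 0" for x
    using irr by (auto simp: irreducible_rates_def)
  have m: "m x > 0" for x
    using p lam by (simp add: m_def)
  have edge0: "A 0 \<le> (H (Suc 0) - H 0)\<^sup>2 / p 0"
    using p[of 0] lam[of 0] by (simp add: A_def m_def mod_death_def H0)
  have edge: "A (Suc y) + B y \<le> (H (Suc (Suc y)) - H (Suc y))\<^sup>2 / p (Suc y)" for y
  proof -
    define r where "r = nu (Suc y) * u y / (lam (Suc y) * u (Suc y))"
    have r: "r > 0"
      using u lam nu by (simp add: r_def)
    have A: "A (Suc y) = (1 - r) * (H (Suc (Suc y)))\<^sup>2 / p (Suc y)"
      using u[of "Suc y"] lam[of "Suc y"] p[of "Suc y"]
      by (simp add: A_def r_def m_def mod_death_def field_simps)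
    have my: "m y = p (Suc y) * nu (Suc y)"
      using reversible by (simp add: m_def)
    have B: "B y = (1 - 1 / r) * (H (Suc y))\<^sup>2 / p (Suc y)"
      using u[of "Suc y"] u[of y] lam[of "Suc y"] nu[of y] p[of "Suc y"]
      by (simp add: B_def r_def my mod_birth_def field_simps)
    have "((1 - r) * (H (Suc (Suc y)))\<^sup>2 + (1 - 1 / r) * (H (Suc y))\<^sup>2) / p (Suc y)
        \<le> (H (Suc (Suc y)) - H (Suc y))\<^sup>2 / p (Suc y)"
      by (intro divide_right_mono square_diff_ground_state r) (use p in \<open>simp add: less_imp_le\<close>)
    then show ?thesis
      by (simp add: A B add_divide_distrib)
  qed
  have "c * (\<Sum>x<N. (H (Suc x))\<^sup>2 / m x) = (\<Sum>x<N. c * ((H (Suc x))\<^sup>2 / m x))"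
    by (simp add: sum_distrib_left)
  also have "\<dots> \<le> (\<Sum>x<N. A x + B x)"
  proof (intro sum_mono)
    fix x
    have "c * ((H (Suc x))\<^sup>2 / m x) \<le> potential lam nu u x * ((H (Suc x))\<^sup>2 / m x)"
      using potential m by (intro mult_right_mono) (simp_all add: less_imp_le)
    also have "\<dots> = A x + B x"
      using m[of x] by (simp add: A_def B_def potential_def field_simps)
    finally show "c * ((H (Suc x))\<^sup>2 / m x) \<le> A x + B x" .
  qed
  also have "\<dots> = (\<Sum>x<N. B x) + (\<Sum>x\<le>N. A x)"
    by (simp add: sum.distrib lessThan_Suc_atMost[symmetric] A_def[of N] HN)
  also have "(\<Sum>x\<le>N. A x) = A 0 + (\<Sum>x<N. A (Suc x))"
    by (simp only: sum.atMost_shift)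
  also have "(\<Sum>x<N. B x) + (A 0 + (\<Sum>x<N. A (Suc x))) = A 0 + (\<Sum>y<N. A (Suc y) + B y)"
    by (simp add: sum.distrib)
  also have "\<dots> \<le> (H (Suc 0) - H 0)\<^sup>2 / p 0
      + (\<Sum>y<N. (H (Suc (Suc y)) - H (Suc y))\<^sup>2 / p (Suc y))"
    by (intro add_mono sum_mono edge0 edge)
  also have "\<dots> = (\<Sum>x\<le>N. (H (Suc x) - H x)\<^sup>2 / p x)"
    by (simp only: sum.atMost_shift)
  finally show ?thesis
    by (simp add: m_def)
qed

section \<open>The Poincare inequality on a finite window\<close>

lemma sum_by_parts_atMost:
  fixes f H :: "nat \<Rightarrow> real"
  assumes "H 0 = 0"
  shows "(\<Sum>x\<le>N. f x * (H (Suc x) - H x))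
    = f N * H (Suc N) - (\<Sum>x<N. H (Suc x) * (f (Suc x) - f x))"
  using assms by (induction N) (simp_all add: algebra_simps)

text \<open>Young's inequality is used with weights tuned so that the Hardy inequality turns the term in
  \<open>H\<close> into exactly half of the left-hand side, which is then absorbed.\<close>

lemma finite_window_poincare_centred:
  fixes p lam nu u f :: "nat \<Rightarrow> real" and c :: real
  assumes p: "\<And>x. p x > 0"
    and irr: "irreducible_rates lam nu"
    and reversible: "\<And>x. p x * lam x = p (Suc x) * nu (Suc x)"
    and u: "\<And>x. u x > 0"
    and potential: "\<And>x. c \<le> potential lam nu u x"
    and c: "c > 0"
    and centred: "(\<Sum>x\<le>N. p x * f x) = 0"
  shows "c * (\<Sum>x\<le>N. p x * (f x)\<^sup>2) \<le> (\<Sum>x<N. p x * lam x * (fwd_diff f x)\<^sup>2)"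
proof -
  define m where "m x = p x * lam x" for x
  define H where "H x = (\<Sum>y<x. p y * f y)" for x
  define S where "S = (\<Sum>x\<le>N. p x * (f x)\<^sup>2)"
  define E where "E = (\<Sum>x<N. m x * (fwd_diff f x)\<^sup>2)"
  have m: "m x > 0" for x
    using p irr by (simp add: m_def irreducible_rates_def)
  have H0: "H 0 = 0" and HN: "H (Suc N) = 0"
    using centred by (simp_all only: H_def lessThan_Suc_atMost) simp
  have incr: "H (Suc x) - H x = p x * f x" for x
    by (simp add: H_def)
  have "(\<Sum>x\<le>N. (H (Suc x) - H x)\<^sup>2 / p x) = S"
    unfolding S_def
  proof (rule sum.cong)
    fix x
    show "(H (Suc x) - H x)\<^sup>2 / p x = p x * (f x)\<^sup>2"
      using p[of x] by (simp add: incr power2_eq_square)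
  qed simp
  then have hardy: "c * (\<Sum>x<N. (H (Suc x))\<^sup>2 / m x) \<le> S"
    using weighted_hardy_of_potential[OF p irr reversible u potential H0 HN]
    by (simp add: m_def)
  have young: "- (H (Suc x) * (f (Suc x) - f x))
      \<le> c / 2 * ((H (Suc x))\<^sup>2 / m x) + 1 / (2 * c) * (m x * (fwd_diff f x)\<^sup>2)" for x
  proof -
    have "0 \<le> (c * H (Suc x) + m x * fwd_diff f x)\<^sup>2 / (2 * c * m x)"
      using m[of x] c by simp
    also have "\<dots> = c / 2 * ((H (Suc x))\<^sup>2 / m x) + 1 / (2 * c) * (m x * (fwd_diff f x)\<^sup>2)
        + H (Suc x) * (f (Suc x) - f x)"
      using m[of x] c by (simp add: fwd_diff_def field_simps power2_eq_square)
    finally show ?thesis by simp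
  qed
  have "S = (\<Sum>x\<le>N. f x * (H (Suc x) - H x))"
    by (simp add: S_def incr power2_eq_square mult_ac)
  also have "\<dots> = (\<Sum>x<N. - (H (Suc x) * (f (Suc x) - f x)))"
    by (simp add: sum_by_parts_atMost[of H, OF H0] HN sum_negf)
  also have "\<dots> \<le> (\<Sum>x<N. c / 2 * ((H (Suc x))\<^sup>2 / m x) + 1 / (2 * c) * (m x * (fwd_diff f x)\<^sup>2))"
    by (intro sum_mono young)
  also have "\<dots> = (c * (\<Sum>x<N. (H (Suc x))\<^sup>2 / m x)) / 2 + E / (2 * c)"
    unfolding sum.distrib sum_distrib_left[symmetric] E_def by simp
  also have "\<dots> \<le> S / 2 + E / (2 * c)"
    using hardy by simp
  finally have "c * S \<le> E"
    using c by (simp add: field_simps)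
  then show ?thesis
    by (simp add: S_def E_def m_def)
qed

lemma finite_window_poincare:
  fixes p lam nu u f :: "nat \<Rightarrow> real" and c :: real
  assumes p: "\<And>x. p x > 0"
    and irr: "irreducible_rates lam nu"
    and reversible: "\<And>x. p x * lam x = p (Suc x) * nu (Suc x)"
    and u: "\<And>x. u x > 0"
    and potential: "\<And>x. c \<le> potential lam nu u x"
    and c: "c > 0"
  shows "c * ((\<Sum>x\<le>N. p x * (f x)\<^sup>2) - (\<Sum>x\<le>N. p x * f x)\<^sup>2 / (\<Sum>x\<le>N. p x))
    \<le> (\<Sum>x<N. p x * lam x * (fwd_diff f x)\<^sup>2)"
proof -
  define P where "P = (\<Sum>x\<le>N. p x)"
  define F where "F = (\<Sum>x\<le>N. p x * f x)"
  define g where "g x = f x - F / P" for x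
  have P: "P > 0"
    unfolding P_def using p by (intro sum_pos) auto
  have "(\<Sum>x\<le>N. p x * g x) = F - P * (F / P)"
    by (simp add: g_def right_diff_distrib sum_subtractf F_def P_def sum_distrib_right
        sum_divide_distrib)
  then have centred: "(\<Sum>x\<le>N. p x * g x) = 0"
    using P by simp
  have "p x * (g x)\<^sup>2 = p x * (f x)\<^sup>2 - 2 * (F / P) * (p x * f x) + (F / P)\<^sup>2 * p x" for x
    by (simp add: g_def power2_eq_square algebra_simps)
  then have "(\<Sum>x\<le>N. p x * (g x)\<^sup>2)
      = (\<Sum>x\<le>N. p x * (f x)\<^sup>2) - 2 * (F / P) * F + (F / P)\<^sup>2 * P"
    by (simp only: sum.distrib sum_subtractf F_def P_def sum_distrib_left)
  also have "\<dots> = (\<Sum>x\<le>N. p x * (f x)\<^sup>2) - F\<^sup>2 / P"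
    using P by (simp add: field_simps power2_eq_square)
  finally have var: "(\<Sum>x\<le>N. p x * (g x)\<^sup>2) = (\<Sum>x\<le>N. p x * (f x)\<^sup>2) - F\<^sup>2 / P" .
  have "fwd_diff g = fwd_diff f"
    by (simp add: fun_eq_iff fwd_diff_def g_def)
  then show ?thesis
    using finite_window_poincare_centred[OF p irr reversible u potential c centred]
    by (simp add: var F_def P_def)
qed

section \<open>The stationary distribution\<close>

definition stationary_pmf :: "(nat \<Rightarrow> real) \<Rightarrow> (nat \<Rightarrow> real) \<Rightarrow> nat \<Rightarrow> real" where
  "stationary_pmf lam nu x = bd_weight lam nu x / (\<Sum>y. bd_weight lam nu y)"

lemma bd_weight_pos:
  assumes "irreducible_rates lam nu"
  shows "bd_weight lam nu x > 0"
  using assms unfolding bd_weight_def irreducible_rates_def by (intro prod_pos) auto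

lemma stationary_pmf_pos:
  assumes "irreducible_rates lam nu" "positive_recurrent lam nu"
  shows "stationary_pmf lam nu x > 0"
proof -
  have "summable (bd_weight lam nu)"
    using assms(2) unfolding positive_recurrent_def by (subst (asm) summable_Suc_iff)
  then have "(\<Sum>y. bd_weight lam nu y) > 0"
    by (intro suminf_pos bd_weight_pos assms(1))
  then show ?thesis
    by (simp add: stationary_pmf_def bd_weight_pos assms(1))
qed

lemma stationary_pmf_sums_one:
  assumes "irreducible_rates lam nu" "positive_recurrent lam nu"
  shows "stationary_pmf lam nu sums 1"
proof -
  have s: "summable (bd_weight lam nu)"
    using assms(2) unfolding positive_recurrent_def by (subst (asm) summable_Suc_iff)
  have "(\<Sum>y. bd_weight lam nu y) > 0"
    by (intro suminf_pos s bd_weight_pos assms(1))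
  then show ?thesis
    using sums_divide[OF summable_sums[OF s], of "\<Sum>y. bd_weight lam nu y"]
    by (simp add: stationary_pmf_def[abs_def])
qed

lemma stationary_pmf_reversible:
  assumes "irreducible_rates lam nu"
  shows "stationary_pmf lam nu x * lam x = stationary_pmf lam nu (Suc x) * nu (Suc x)"
proof -
  have "nu (Suc x) > 0"
    using assms by (simp add: irreducible_rates_def)
  then show ?thesis
    by (simp add: stationary_pmf_def bd_weight_def)
qed

lemma stationary_eq_density:
  "stationary lam nu = density (count_space UNIV) (\<lambda>x. ennreal (stationary_pmf lam nu x))"
  by (simp add: stationary_def stationary_pmf_def)

lemma integrable_stationary_iff:
  fixes f :: "nat \<Rightarrow> real"
  assumes "irreducible_rates lam nu" "positive_recurrent lam nu"
  shows "integrable (stationary lam nu) f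
    \<longleftrightarrow> summable (\<lambda>x. stationary_pmf lam nu x * \<bar>f x\<bar>)"
  unfolding stationary_eq_density
  using stationary_pmf_pos[OF assms]
  by (subst integrable_density)
    (simp_all add: integrable_count_space_nat_iff abs_mult less_imp_le)

lemma integral_stationary_sums:
  fixes f :: "nat \<Rightarrow> real"
  assumes "irreducible_rates lam nu" "positive_recurrent lam nu"
    and "integrable (stationary lam nu) f"
  shows "(\<lambda>x. stationary_pmf lam nu x * f x) sums (\<integral>x. f x \<partial>stationary lam nu)"
proof -
  have "(\<integral>x. f x \<partial>stationary lam nu)
      = (\<integral>x. stationary_pmf lam nu x * f x \<partial>count_space UNIV)"
    unfolding stationary_eq_density using stationary_pmf_pos[OF assms(1,2)]
    by (subst integral_density) (simp_all add: less_imp_le)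
  moreover have "integrable (count_space UNIV) (\<lambda>x. stationary_pmf lam nu x * f x)"
    using assms(3) unfolding stationary_eq_density
    by (subst (asm) integrable_density)
      (simp_all add: less_imp_le stationary_pmf_pos[OF assms(1,2)])
  ultimately show ?thesis
    using sums_integral_count_space_nat by metis
qed

lemma dirichlet_domain_integrable:
  assumes "irreducible_rates lam nu" "positive_recurrent lam nu"
    and "f \<in> dirichlet_domain lam nu"
  shows "integrable (stationary lam nu) (\<lambda>x. (f x)\<^sup>2)"
    and "integrable (stationary lam nu) f"
    and "integrable (stationary lam nu) (\<lambda>x. lam x * fwd_diff f x * fwd_diff f x)"
proof -
  let ?p = "stationary_pmf lam nu"
  have lam: "lam x > 0" for x
    using assms(1) by (simp add: irreducible_rates_def)
  show sq: "integrable (stationary lam nu) (\<lambda>x. (f x)\<^sup>2)"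
    using assms(3) by (simp add: dirichlet_domain_def)
  have "summable (\<lambda>x. ?p x + ?p x * (f x)\<^sup>2)"
    using sq stationary_pmf_sums_one[OF assms(1,2)]
    by (intro summable_add) (auto simp: integrable_stationary_iff[OF assms(1,2)] sums_iff)
  moreover have "\<bar>y\<bar> \<le> 1 + y\<^sup>2" for y :: real
  proof -
    have "0 \<le> (\<bar>y\<bar> - 1)\<^sup>2"
      by simp
    also have "\<dots> = 1 + y\<^sup>2 - 2 * \<bar>y\<bar>"
      by (simp add: power2_eq_square algebra_simps)
    finally show ?thesis by simp
  qed
  then have "?p x * \<bar>f x\<bar> \<le> ?p x + ?p x * (f x)\<^sup>2" for x
    using mult_left_mono[of "\<bar>f x\<bar>" "1 + (f x)\<^sup>2" "?p x"] stationary_pmf_pos[OF assms(1,2), of x]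
    by (simp add: distrib_left)
  then have "norm (?p x * \<bar>f x\<bar>) \<le> ?p x + ?p x * (f x)\<^sup>2" for x
    using stationary_pmf_pos[OF assms(1,2), of x] by (simp add: abs_mult)
  ultimately show "integrable (stationary lam nu) f"
    unfolding integrable_stationary_iff[OF assms(1,2)]
    by (rule summable_comparison_test'[where N = 0])
  show "integrable (stationary lam nu) (\<lambda>x. lam x * fwd_diff f x * fwd_diff f x)"
    using assms(3) lam
    by (intro integrableI_nonneg)
      (auto simp: dirichlet_domain_def stationary_def mult.assoc less_imp_le)
qed

section \<open>From curvature to the spectral gap\<close>

lemma poincare_inequality_of_potential:
  assumes irr: "irreducible_rates lam nu" and rec: "positive_recurrent lam nu"
    and u: "\<And>x. u x > 0"
    and potential: "\<And>x. c \<le> potential lam nu u x"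
    and c: "c > 0"
  shows "poincare_inequality lam nu c"
  unfolding poincare_inequality_def
proof
  fix f assume f: "f \<in> dirichlet_domain lam nu"
  let ?p = "stationary_pmf lam nu" and ?M = "stationary lam nu"
  note p = stationary_pmf_pos[OF irr rec]
  note int = dirichlet_domain_integrable[OF irr rec f]
  have energy: "(\<lambda>x. ?p x * lam x * (fwd_diff f x)\<^sup>2) sums dirichlet_form lam nu f f"
    using integral_stationary_sums[OF irr rec int(3)]
    by (simp add: dirichlet_form_def power2_eq_square mult.assoc)
  have "(\<lambda>N. c * ((\<Sum>x\<le>N. ?p x * (f x)\<^sup>2) - (\<Sum>x\<le>N. ?p x * f x)\<^sup>2 / (\<Sum>x\<le>N. ?p x)))
      \<longlonglongrightarrow> c * ((\<integral>x. (f x)\<^sup>2 \<partial>?M) - (\<integral>x. f x \<partial>?M)\<^sup>2 / 1)"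
    using integral_stationary_sums[OF irr rec int(1)] integral_stationary_sums[OF irr rec int(2)]
      stationary_pmf_sums_one[OF irr rec]
    by (intro tendsto_intros) (simp_all add: sums_def_le)
  moreover have "c * ((\<Sum>x\<le>N. ?p x * (f x)\<^sup>2) - (\<Sum>x\<le>N. ?p x * f x)\<^sup>2 / (\<Sum>x\<le>N. ?p x))
      \<le> dirichlet_form lam nu f f" for N
  proof -
    have "(\<Sum>x<N. ?p x * lam x * (fwd_diff f x)\<^sup>2) \<le> dirichlet_form lam nu f f"
      unfolding sums_unique[OF energy] using irr p
      by (intro sum_le_suminf sums_summable[OF energy])
        (auto simp: irreducible_rates_def less_imp_le)
    then show ?thesis
      using finite_window_poincare[OF p irr stationary_pmf_reversible[OF irr] u potential c]
      by (meson order_trans)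
  qed
  ultimately have "c * ((\<integral>x. (f x)\<^sup>2 \<partial>?M) - (\<integral>x. f x \<partial>?M)\<^sup>2 / 1) \<le> dirichlet_form lam nu f f"
    using LIMSEQ_le_const2 by blast
  then show "c * variance_wrt ?M f \<le> dirichlet_form lam nu f f"
    by (simp add: variance_wrt_def)
qed

text \<open>The constants admissible in the Poincare inequality form a closed set, because the inequality
  is affine in the constant for each \<open>f\<close>.\<close>

lemma poincare_inequality_limit:
  assumes "\<And>c'. 0 < c' \<Longrightarrow> c' < c \<Longrightarrow> poincare_inequality lam nu c'" and "0 < c"
  shows "poincare_inequality lam nu c"
  unfolding poincare_inequality_def
proof
  fix f assume f: "f \<in> dirichlet_domain lam nu"
  let ?V = "variance_wrt (stationary lam nu) f"
  have "((\<lambda>c'. c' * ?V) \<longlongrightarrow> c * ?V) (at_left c)"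
    by (intro tendsto_intros)
  moreover have "eventually (\<lambda>c'. c' * ?V \<le> dirichlet_form lam nu f f) (at_left c)"
    using eventually_at_left_real[OF assms(2)]
    by eventually_elim (use assms(1) f in \<open>auto simp: poincare_inequality_def\<close>)
  ultimately show "c * ?V \<le> dirichlet_form lam nu f f"
    by (intro tendsto_upperbound) auto
qed

text \<open>At \<open>0\<close> the modified death rate vanishes and the modified birth rate is positive, so the potential
  there is bounded independently of \<open>u\<close>.\<close>

lemma wasserstein_curvature_le:
  assumes "irreducible_rates lam nu" and "\<And>x. u x > 0"
  shows "wasserstein_curvature lam nu u \<le> ereal (nu 1 + lam 0)"
proof -
  have "mod_birth lam u 0 \<ge> 0"
    using assms by (simp add: mod_birth_def irreducible_rates_def less_imp_le)
  then have "potential lam nu u 0 \<le> nu 1 + lam 0"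
    by (simp add: potential_def mod_death_def)
  then show ?thesis
    unfolding wasserstein_curvature_def by (intro INF_lower2[of 0]) auto
qed

theorem corollary3p3:
  fixes lam nu :: "nat \<Rightarrow> real"
  assumes "irreducible_rates lam nu"
    and "nonexplosive lam nu"
    and "positive_recurrent lam nu"
    and "\<exists>u\<in>F_plus lam nu. wasserstein_curvature lam nu u > 0"
  shows "(\<exists>c::real. ereal c = (SUP u\<in>F_plus lam nu. wasserstein_curvature lam nu u) \<and>
             poincare_inequality lam nu c) \<and>
         (SUP u\<in>F_plus lam nu. wasserstein_curvature lam nu u) \<le> poincare_constant lam nu"
proof -
  let ?S = "SUP u\<in>F_plus lam nu. wasserstein_curvature lam nu u"
  have u: "u x > 0" if "u \<in> F_plus lam nu" for u x
    using that by (simp add: F_plus_def)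
  have "?S \<le> ereal (nu 1 + lam 0)"
    by (intro SUP_least wasserstein_curvature_le assms(1) u)
  moreover have pos: "?S > 0"
    using assms(4) by (auto simp: less_SUP_iff)
  ultimately obtain c where c: "?S = ereal c"
    by (cases ?S) auto
  have poincare: "poincare_inequality lam nu c"
  proof (rule poincare_inequality_limit)
    show "0 < c"
      using pos c by simp
  next
    fix c' assume c': "0 < c'" "c' < c"
    then have "ereal c' < ?S"
      using c by simp
    then obtain v where v: "v \<in> F_plus lam nu" "ereal c' < wasserstein_curvature lam nu v"
      by (auto simp: less_SUP_iff)
    have "c' \<le> potential lam nu v x" for x
    proof -
      have "wasserstein_curvature lam nu v \<le> ereal (potential lam nu v x)"
        unfolding wasserstein_curvature_def by (intro INF_lower) simp
      with v(2) have "ereal c' < ereal (potential lam nu v x)"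
        by (rule less_le_trans)
      then show ?thesis by simp
    qed
    then show "poincare_inequality lam nu c'"
      by (intro poincare_inequality_of_potential[OF assms(1,3) u[OF v(1)]] c'(1))
  qed
  have "ereal c \<le> poincare_constant lam nu"
    unfolding poincare_constant_def using poincare by (intro SUP_upper) simp
  with c poincare show ?thesis
    by auto
qed

end
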